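(* Let $\mathcal{A},\mathcal{B}$ be sets and let $s_{y|x}:\mathbb{R}^D\to\mathbb{R}$ be continuously differentiable for all $x\in\mathcal{B}$, $y\in\mathcal{A}$. Assume that $\mathcal{C}$ is an interval of $\mathbb{R}$, that $\ell:\mathbb{R}\times\mathcal{C}\to\mathbb{R}$ and $\mathcal{R}:\mathbb{R}^D\to\mathbb{R}$ are twice continuously differentiable, and that $\partial_c\partial_s\ell(s,c)<0$ for all $s\in\mathbb{R}$ and $c\in\mathcal{C}$. Let $\mathbf{D}$ be a dataset and $\theta^*\in\mathbb{R}^D$. If $\nabla\mathrm{Loss}(\theta^*|\mathbf{D})=0$, $\nabla^2\mathrm{Loss}(\theta^*|\mathbf{D})\succ 0$ and $\nabla s_{zy|x}(\theta^* )\ne 0$ for all $(x,y,z,c)\in\mathbf{D}$, then $\mathrm{Loss}$ with dataset $\mathbf{D}$ is locally pairwise monotone at $\theta^*$ for comparison intensification; that is, there exist a neighborhood $\mathcal{U}$ of $\theta^*$ and $\varepsilon_0>0$ such that for all $(x,y,z)\in\mathcal{B}\times\mathcal{A}\times\mathcal{A}$, all $0<\varepsilon\le\varepsilon_0$ and all $\theta^\varepsilon\in\operatorname*{arg\,min}_{\theta\in\mathcal{U}}\mathrm{Loss}(\theta|\mathbf{D}+\Delta^\varepsilon_{yz|x})$, one has $s_{yz|x}(\theta^\varepsilon)\ge s_{yz|x}(\theta^* )$.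
   Context: $\mathcal{A}$ is a set of alternatives, $\mathcal{B}$ a set of backgrounds, $\mathcal{C}\subset\mathbb{R}$ a set of possible comparison values. A dataset $\mathbf{D}$ is a finite multiset of elements $(x,y,z,c)\in\mathcal{B}\times\mathcal{A}\times\mathcal{A}\times\mathcal{C}$. For a parametrized score $s_{y|x}(\theta)\in\mathbb{R}$ ($\theta\in\mathbb{R}^D$), write $s_{yz|x}(\theta)=s_{y|x}(\theta)-s_{z|x}(\theta)$. The loss is $$\mathrm{Loss}(\theta|\mathbf{D})=\mathcal{R}(\theta)+\sum_{(x,y,z,c)\in\mathbf{D}}\ell(s_{yz|x}(\theta),c),$$ with $\mathcal{R}$ a (possibly zero) regularization. $\partial_s,\partial_c$ are derivatives of $\ell(s,c)$ in the first and second variables. $\nabla,\nabla^2$ denote gradient and Hessian in $\theta$ (the Hessian hypothesis includes that $\mathrm{Loss}(\cdot|\mathbf{D})$ is twice differentiable at $\theta^*$), and $\succ 0$ means positive definite. Intensification: for a triple $(x,y,z)$ and $\varepsilon>0$, set $\mathrm{push}^{x,y,z}_\varepsilon(c'|x',y',z')=\mathrm{proj}_{\mathcal{C}}(c'-\varepsilon)$ if $(x',y',z')=(x,z,y)$, $=\mathrm{proj}_{\mathcal{C}}(c'+\varepsilon)$ if $(x',y',z')=(x,y,z)$, and $=c'$ otherwise, where $\mathrm{proj}_{\mathcal{C}}(t)=\operatorname*{arg\,min}_{c\in\mathcal{C}}|t-c|$. Then $\mathbf{D}+\Delta^\varepsilon_{yz|x}$ is the multiset of all $(x',y',z',\mathrm{push}^{x,y,z}_\varepsilon(c'|x',y',z'))$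 with $(x',y',z',c')\in\mathbf{D}$. *)

theory Defs
  imports "HOL-Analysis.Analysis" "HOL-Library.Multiset"
begin

text \<open>
  Derivatives are taken within \<open>S\<close>, so they are one-sided at boundary points belonging to \<open>S\<close>.
\<close>

definition C1_on :: "('a::real_normed_vector \<Rightarrow> 'b::real_normed_vector) \<Rightarrow> 'a set \<Rightarrow> bool" where
  "C1_on f S \<longleftrightarrow>
     (\<exists>f' :: 'a \<Rightarrow> 'a \<Rightarrow>\<^sub>L 'b.
        (\<forall>x\<in>S. (f has_derivative blinfun_apply (f' x)) (at x within S)) \<and>
        continuous_on S f')"

definition C2_on :: "('a::real_normed_vector \<Rightarrow> 'b::real_normed_vector) \<Rightarrow> 'a set \<Rightarrow> bool" where
  "C2_on f S \<longleftrightarrow>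
     (\<exists>f' :: 'a \<Rightarrow> 'a \<Rightarrow>\<^sub>L 'b.
        (\<forall>x\<in>S. (f has_derivative blinfun_apply (f' x)) (at x within S)) \<and>
        C1_on f' S)"

definition partial_s :: "(real \<Rightarrow> real \<Rightarrow> real) \<Rightarrow> real \<Rightarrow> real \<Rightarrow> real" where
  "partial_s l s c = deriv (\<lambda>s'. l s' c) s"

definition partial_c :: "real set \<Rightarrow> (real \<Rightarrow> real \<Rightarrow> real) \<Rightarrow> real \<Rightarrow> real \<Rightarrow> real" where
  "partial_c C l s c = vector_derivative (l s) (at c within C)"

definition gradient :: "(real^'d \<Rightarrow> real) \<Rightarrow> real^'d \<Rightarrow> real^'d" where
  "gradient f \<theta> = (THE g. GDERIV f \<theta> :> g)"

definition twice_differentiable_at :: "(real^'d \<Rightarrow> real) \<Rightarrow> real^'d \<Rightarrow> bool" where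
  "twice_differentiable_at f \<theta> \<longleftrightarrow>
     (\<forall>\<^sub>F \<theta>' in nhds \<theta>. f differentiable (at \<theta>')) \<and> gradient f differentiable (at \<theta>)"

definition hessian :: "(real^'d \<Rightarrow> real) \<Rightarrow> real^'d \<Rightarrow> real^'d^'d" where
  "hessian f \<theta> = jacobian (gradient f) (at \<theta>)"

text \<open>
  Symmetry is not part of this definition: the Hessian at a point of twice
  differentiability is automatically symmetric.
\<close>

definition positive_definite :: "real^'d^'d \<Rightarrow> bool" where
  "positive_definite H \<longleftrightarrow> (\<forall>v. v \<noteq> 0 \<longrightarrow> v \<bullet> (H *v v) > 0)"

text \<open>
  A score \<open>s\<close> is applied as \<open>s y x \<theta>\<close> for $s_{y|x}(\theta)$, and a data point is a tuple
  \<open>(x, y, z, c)\<close> of a background, two alternatives and a comparison value.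
\<close>

type_synonym ('a, 'b) dataset = "('b \<times> 'a \<times> 'a \<times> real) multiset"

definition score_diff ::
    "('a \<Rightarrow> 'b \<Rightarrow> real^'d \<Rightarrow> real) \<Rightarrow> 'a \<Rightarrow> 'a \<Rightarrow> 'b \<Rightarrow> real^'d \<Rightarrow> real" where
  "score_diff s y z x \<theta> = s y x \<theta> - s z x \<theta>"

definition Loss ::
    "(real^'d \<Rightarrow> real) \<Rightarrow> (real \<Rightarrow> real \<Rightarrow> real) \<Rightarrow> ('a \<Rightarrow> 'b \<Rightarrow> real^'d \<Rightarrow> real)
      \<Rightarrow> ('a, 'b) dataset \<Rightarrow> real^'d \<Rightarrow> real" where
  "Loss R l s D \<theta> = R \<theta> + (\<Sum>(x, y, z, c) \<in># D. l (score_diff s y z x \<theta>) c)"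

text \<open>
  If \<open>C\<close> is not closed the minimum need not be attained and the value is then unspecified; for
  an interval \<open>C\<close> this does not affect \<open>proj_on C (c \<plusminus> \<epsilon>)\<close> when \<open>c \<in> C\<close> and \<open>\<epsilon>\<close> is small.
\<close>

definition proj_on :: "real set \<Rightarrow> real \<Rightarrow> real" where
  "proj_on C t = arg_min (\<lambda>c. \<bar>t - c\<bar>) (\<lambda>c. c \<in> C)"

definition push ::
    "real set \<Rightarrow> 'b \<Rightarrow> 'a \<Rightarrow> 'a \<Rightarrow> real \<Rightarrow> real \<Rightarrow> 'b \<Rightarrow> 'a \<Rightarrow> 'a \<Rightarrow> real" where
  "push C x y z \<epsilon> c' x' y' z' =
     (if (x', y', z') = (x, z, y) then proj_on C (c' - \<epsilon>)
      else if (x', y', z') = (x, y, z) then proj_on C (c' + \<epsilon>)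
      else c')"

definition intensify ::
    "real set \<Rightarrow> 'b \<Rightarrow> 'a \<Rightarrow> 'a \<Rightarrow> real \<Rightarrow> ('a, 'b) dataset \<Rightarrow> ('a, 'b) dataset" where
  "intensify C x y z \<epsilon> D =
     {# (x', y', z', push C x y z \<epsilon> c' x' y' z'). (x', y', z', c') \<in># D #}"

definition locally_pairwise_monotone ::
    "'a set \<Rightarrow> 'b set \<Rightarrow> real set \<Rightarrow> ('a \<Rightarrow> 'b \<Rightarrow> real^'d \<Rightarrow> real)
      \<Rightarrow> (('a, 'b) dataset \<Rightarrow> real^'d \<Rightarrow> real) \<Rightarrow> ('a, 'b) dataset \<Rightarrow> real^'d \<Rightarrow> bool" where
  "locally_pairwise_monotone A B C s L D \<theta>\<^sub>0 \<longleftrightarrow>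
     (\<exists>U \<epsilon>\<^sub>0. \<theta>\<^sub>0 \<in> interior U \<and> \<epsilon>\<^sub>0 > 0 \<and>
       (\<forall>x\<in>B. \<forall>y\<in>A. \<forall>z\<in>A. \<forall>\<epsilon>. 0 < \<epsilon> \<and> \<epsilon> \<le> \<epsilon>\<^sub>0 \<longrightarrow>
         (\<forall>\<theta>. is_arg_min (L (intensify C x y z \<epsilon> D)) (\<lambda>\<theta>. \<theta> \<in> U) \<theta> \<longrightarrow>
               score_diff s y z x \<theta> \<ge> score_diff s y z x \<theta>\<^sub>0)))"

end

theory Submission imports Defs begin

text \<open>
  A positive definite Hessian makes \<open>\<theta>\<^sub>0\<close> a strict minimum of the loss on some ball \<open>U\<close>.
  Intensification adds to the loss a function of \<open>\<theta>\<close> that depends only on the score difference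
  $s_{yz|x}(\theta)$ and is nonincreasing in it, since $\partial_c\partial_s\ell < 0$. A point of
  \<open>U\<close> with a smaller score difference than \<open>\<theta>\<^sub>0\<close> therefore has a larger loss than \<open>\<theta>\<^sub>0\<close> and a
  perturbation at least as large, so it cannot minimise the perturbed loss.
\<close>

section \<open>Second-order sufficient condition for a strict local minimum\<close>

text \<open>Riesz representation: a linear functional \<open>f'\<close> on a Euclidean space is the
  inner product with \<open>adjoint f' 1\<close>. Uniqueness of derivatives then makes the
  \<open>THE\<close> in \<open>gradient\<close> well defined.\<close>

lemma GDERIV_gradient:
  fixes f :: "real^'d \<Rightarrow> real"
  assumes "f differentiable (at \<theta>)"
  shows "GDERIV f \<theta> :> gradient f \<theta>"
proof -
  from assms obtain f' where f': "(f has_derivative f') (at \<theta>)"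
    by (auto simp: differentiable_def)
  then have "linear f'"
    by (rule has_derivative_linear)
  then have "f' = (\<lambda>h. h \<bullet> adjoint f' 1)"
    using adjoint_works[of f' _ 1] by (simp add: fun_eq_iff)
  with f' have deriv: "GDERIV f \<theta> :> adjoint f' 1"
    unfolding gderiv_def by metis
  have uniq: "g = g'" if "GDERIV f \<theta> :> g" "GDERIV f \<theta> :> g'" for g g'
  proof -
    have "(\<lambda>h. h \<bullet> g) = (\<lambda>h. h \<bullet> g')"
      using that unfolding gderiv_def by (rule has_derivative_unique)
    then show ?thesis
      by (simp add: fun_eq_iff vector_eq_ldot)
  qed
  show ?thesis
    unfolding gradient_def by (rule theI[of "gderiv f \<theta>", OF deriv uniq[OF _ deriv]])
qed

text \<open>The quadratic form attains a minimum on the compact unit sphere, and this minimum is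
  positive. It serves as \<open>m\<close>, since the form is homogeneous of degree 2.\<close>

lemma positive_definite_coercive:
  fixes H :: "real^'d^'d"
  assumes "positive_definite H"
  obtains m where "m > 0" "\<And>v. m * (norm v)\<^sup>2 \<le> v \<bullet> (H *v v)"
proof -
  let ?q = "\<lambda>v. v \<bullet> (H *v v)"
  have "continuous_on (sphere 0 1) ?q"
    by (intro continuous_intros linear_continuous_on_compose linear_continuous_on
        matrix_vector_mul_bounded_linear)
  moreover have "sphere (0::real^'d) 1 \<noteq> {}"
    by (metis insert_not_empty mem_sphere_0 norm_axis_1 equals0D)
  ultimately obtain w where w: "w \<in> sphere 0 1" "\<And>v. v \<in> sphere 0 1 \<Longrightarrow> ?q w \<le> ?q v"
    using continuous_attains_inf[of "sphere 0 1" ?q] by auto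
  show ?thesis
  proof
    show "?q w > 0"
      using w(1) assms[unfolded positive_definite_def, rule_format, of w] by fastforce
    show "?q w * (norm v)\<^sup>2 \<le> ?q v" for v
    proof (cases "v = 0")
      case False
      then have "?q w \<le> ?q (inverse (norm v) *\<^sub>R v)"
        by (intro w(2)) simp
      also have "\<dots> = ?q v / (norm v)\<^sup>2"
        by (simp add: matrix_vector_mult_scaleR power2_eq_square field_simps)
      finally show ?thesis
        using False by (simp add: field_simps)
    qed simp
  qed
qed

text \<open>The Hessian is only known at the point itself, so the gradient is expanded there to
  first order. This shows that \<open>f\<close> has positive radial derivative near
  \<open>\<theta>\<^sub>0\<close>, hence increases strictly along every ray.\<close>

lemma strict_local_min_if_hessian_positive_definite:
  fixes f :: "real^'d \<Rightarrow> real"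
  assumes grad: "gradient f \<theta>\<^sub>0 = 0"
    and diff: "twice_differentiable_at f \<theta>\<^sub>0"
    and pos: "positive_definite (hessian f \<theta>\<^sub>0)"
  obtains r where "r > 0" "\<And>\<theta>. \<theta> \<in> ball \<theta>\<^sub>0 r \<Longrightarrow> \<theta> \<noteq> \<theta>\<^sub>0 \<Longrightarrow> f \<theta>\<^sub>0 < f \<theta>"
proof -
  let ?H = "hessian f \<theta>\<^sub>0"
  obtain m where m: "m > 0" "\<And>v. m * (norm v)\<^sup>2 \<le> v \<bullet> (?H *v v)"
    using positive_definite_coercive[OF pos] by blast
  have "(gradient f has_derivative (\<lambda>h. ?H *v h)) (at \<theta>\<^sub>0)"
    using diff jacobian_works[of "gradient f"]
    unfolding twice_differentiable_at_def hessian_def by blast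
  \<comment> \<open>As the gradient vanishes at \<open>\<theta>\<^sub>0\<close>, its linear
    approximation is the Hessian term alone. The tolerance \<open>m/2\<close> lets the error consume
    at most half of the coercivity bound \<open>m\<close>.\<close>
  then obtain d where d: "d > 0"
    "\<And>\<theta>. norm (\<theta> - \<theta>\<^sub>0) < d \<Longrightarrow>
        norm (gradient f \<theta> - ?H *v (\<theta> - \<theta>\<^sub>0)) \<le> (m/2) * norm (\<theta> - \<theta>\<^sub>0)"
    using m(1) grad unfolding has_derivative_at_alt by (metis diff_zero half_gt_zero)
  obtain e where e: "e > 0" "\<And>\<theta>. dist \<theta> \<theta>\<^sub>0 < e \<Longrightarrow> f differentiable (at \<theta>)"
    using diff unfolding twice_differentiable_at_def eventually_nhds_metric by blast
  have grad_pos: "(\<theta> - \<theta>\<^sub>0) \<bullet> gradient f \<theta> > 0" if "norm (\<theta> - \<theta>\<^sub>0) < d" "\<theta> \<noteq> \<theta>\<^sub>0" for \<theta>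
  proof -
    let ?v = "\<theta> - \<theta>\<^sub>0"
    have "\<bar>?v \<bullet> (gradient f \<theta> - ?H *v ?v)\<bar> \<le> norm ?v * ((m/2) * norm ?v)"
      by (rule order_trans[OF Cauchy_Schwarz_ineq2]) (intro mult_left_mono d that; simp)
    moreover have "norm ?v * ((m/2) * norm ?v) < m * (norm ?v)\<^sup>2"
      using m(1) that(2) by (simp add: power2_eq_square)
    ultimately show ?thesis
      using m(2)[of ?v] unfolding inner_diff_right by linarith
  qed
  show ?thesis
  proof
    show "min d e > 0"
      using d e by simp
    fix \<theta> assume \<theta>: "\<theta> \<in> ball \<theta>\<^sub>0 (min d e)" "\<theta> \<noteq> \<theta>\<^sub>0"
    define v where "v = \<theta> - \<theta>\<^sub>0"
    define \<phi> where "\<phi> t = f (\<theta>\<^sub>0 + t *\<^sub>R v)" for t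
    have v: "norm v < d" "norm v < e" "v \<noteq> 0"
      using \<theta> by (auto simp: v_def dist_norm norm_minus_commute)
    have deriv: "(\<phi> has_real_derivative v \<bullet> gradient f (\<theta>\<^sub>0 + t *\<^sub>R v)) (at t)"
      if "0 \<le> t" "t \<le> 1" for t
    proof -
      have "t * norm v < e"
        using v that mult_left_le_one_le[OF norm_ge_zero that, of v] by linarith
      then have "f differentiable (at (\<theta>\<^sub>0 + t *\<^sub>R v))"
        using that by (intro e) (simp add: dist_norm)
      then have "(f has_derivative (\<lambda>h. h \<bullet> gradient f (\<theta>\<^sub>0 + t *\<^sub>R v))) (at (\<theta>\<^sub>0 + t *\<^sub>R v))"
        using GDERIV_gradient by (simp add: gderiv_def)
      moreover have "((\<lambda>t. \<theta>\<^sub>0 + t *\<^sub>R v) has_derivative (\<lambda>h. h *\<^sub>R v)) (at t)"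
        by (auto intro!: derivative_eq_intros)
      ultimately have "(\<phi> has_derivative (\<lambda>h. (h *\<^sub>R v) \<bullet> gradient f (\<theta>\<^sub>0 + t *\<^sub>R v))) (at t)"
        unfolding \<phi>_def by (rule has_derivative_compose[rotated])
      then show ?thesis
        by (simp add: has_field_derivative_def mult.commute[of _ "v \<bullet> _"])
    qed
    \<comment> \<open>The derivative of \<phi> vanishes at 0, so positivity is available only on the
      open interval, with continuity at the ends. There \<open>grad_pos\<close> applies to the
      displacement \<open>t *\<^sub>R v\<close>, and the factor \<open>t > 0\<close> is divided
      out.\<close>
    have "\<phi> 0 < \<phi> 1"
    proof (rule DERIV_pos_imp_increasing_open[of 0 1 \<phi>])
      fix t :: real assume t: "0 < t" "t < 1"
      then have "t * norm v < d"
        using v by (smt (verit, best) mult_left_le_one_le norm_ge_zero)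
      with t v grad_pos[of "\<theta>\<^sub>0 + t *\<^sub>R v"] have "v \<bullet> gradient f (\<theta>\<^sub>0 + t *\<^sub>R v) > 0"
        by (simp add: zero_less_mult_iff)
      with deriv t show "\<exists>D. (\<phi> has_real_derivative D) (at t) \<and> 0 < D"
        by (meson less_imp_le)
    next
      show "continuous_on {0..1} \<phi>"
        using deriv by (intro continuous_at_imp_continuous_on ballI DERIV_isCont) auto
    qed simp
    then show "f \<theta>\<^sub>0 < f \<theta>"
      by (simp add: \<phi>_def v_def)
  qed
qed

section \<open>Monotonicity of the loss increments\<close>

text \<open>Connects the joint Frechet derivatives on \<open>UNIV \<times> C\<close> with the
  coordinatewise \<open>partial_s\<close> and \<open>partial_c\<close>: restrict to a line in the
  first variable, evaluate at \<open>(1, 0)\<close>, then restrict to a line in the second.\<close>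

lemma C2_on_partial_s:
  fixes l :: "real \<Rightarrow> real \<Rightarrow> real"
  assumes "C2_on (\<lambda>(t, c). l t c) (UNIV \<times> C)" "c \<in> C"
  shows "((\<lambda>t. l t c) has_real_derivative partial_s l t c) (at t)"
    and "(partial_s l t has_vector_derivative partial_c C (partial_s l) t c) (at c within C)"
proof -
  obtain f' :: "real \<times> real \<Rightarrow> (real \<times> real) \<Rightarrow>\<^sub>L real" where f':
    "\<And>p. p \<in> UNIV \<times> C \<Longrightarrow>
      ((\<lambda>(t, c). l t c) has_derivative blinfun_apply (f' p)) (at p within UNIV \<times> C)"
    and "C1_on f' (UNIV \<times> C)"
    using assms(1) unfolding C2_on_def by blast
  then obtain f'' where f'':
    "\<And>p. p \<in> UNIV \<times> C \<Longrightarrow> (f' has_derivative blinfun_apply (f'' p)) (at p within UNIV \<times> C)"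
    unfolding C1_on_def by blast
  have l': "((\<lambda>t. l t c) has_real_derivative f' (t, c) (1, 0)) (at t)" if "c \<in> C" for t c
  proof -
    have "((\<lambda>t. (t, c)) has_derivative (\<lambda>h. (h, 0))) (at t)"
      by (auto intro!: derivative_eq_intros)
    moreover have "range (\<lambda>t. (t, c)) \<subseteq> UNIV \<times> C"
      using that by auto
    ultimately have
      "((\<lambda>t. (\<lambda>(t, c). l t c) (t, c)) has_derivative (\<lambda>h. f' (t, c) (h, 0))) (at t)"
      using that by (intro has_derivative_in_compose2[OF f', where s = UNIV]) auto
    \<comment> \<open>A linear map in one real variable is multiplication by its value at 1.\<close>
    moreover have "(*) (f' (t, c) (1, 0)) = (\<lambda>h. f' (t, c) (h, 0))"
    proof
      show "f' (t, c) (1, 0) * h = f' (t, c) (h, 0)" for h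
        using blinfun.scaleR_right[of "f' (t, c)" h "(1, 0)"] by simp
    qed
    ultimately show ?thesis
      by (simp add: has_field_derivative_def)
  qed
  have ps: "partial_s l t c = f' (t, c) (1, 0)" if "c \<in> C" for t c
    unfolding partial_s_def using l'[OF that] by (rule DERIV_imp_deriv)
  show "((\<lambda>t. l t c) has_real_derivative partial_s l t c) (at t)"
    using l'[OF assms(2)] ps[OF assms(2)] by simp
  have "((\<lambda>c. (t, c)) has_derivative (\<lambda>h. (0, h))) (at c within C)"
    by (auto intro!: derivative_eq_intros)
  then have "((\<lambda>c. f' (t, c)) has_derivative (\<lambda>h. f'' (t, c) (0, h))) (at c within C)"
    using assms(2) by (intro has_derivative_in_compose2[OF f'', where s = C]) auto
  then have "((\<lambda>c. f' (t, c) (1, 0)) has_derivative (\<lambda>h. f'' (t, c) (0, h) (1, 0))) (at c within C)"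
    by (auto intro!: derivative_eq_intros)
  \<comment> \<open>The identity \<open>ps\<close> holds only for comparison values in
    \<open>C\<close>; this suffices because the derivative is taken within \<open>C\<close>.\<close>
  then have "(partial_s l t has_derivative (\<lambda>h. f'' (t, c) (0, h) (1, 0))) (at c within C)"
    using assms(2) by (rule has_derivative_transform[rotated 2]) (simp_all add: ps)
  then have "partial_s l t differentiable (at c within C)"
    by (auto simp: differentiable_def)
  then show "(partial_s l t has_vector_derivative partial_c C (partial_s l) t c) (at c within C)"
    unfolding partial_c_def by (simp add: vector_derivative_works)
qed

text \<open>Mean value theorem in the comparison variable. The segment from \<open>c\<close> to
  \<open>c'\<close> stays in the interval \<open>C\<close>, and derivatives within \<open>C\<close>
  restrict to derivatives within the segment.\<close>

lemma partial_s_antimono: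
  fixes l :: "real \<Rightarrow> real \<Rightarrow> real"
  assumes "C2_on (\<lambda>(t, c). l t c) (UNIV \<times> C)" "is_interval C"
    and neg: "\<And>t c. c \<in> C \<Longrightarrow> partial_c C (partial_s l) t c < 0"
    and "c \<in> C" "c' \<in> C" "c \<le> c'"
  shows "partial_s l t c' \<le> partial_s l t c"
proof (cases "c = c'")
  case False
  have sub: "{c..c'} \<subseteq> C"
    using assms by (meson atLeastAtMost_iff mem_is_interval_1_I subsetI)
  have "(partial_s l t has_derivative (\<lambda>h. h *\<^sub>R partial_c C (partial_s l) t b)) (at b within {c..c'})"
    if "b \<in> {c..c'}" for b
    using that sub C2_on_partial_s(2)[OF assms(1), of b t]
    by (metis has_derivative_subset has_vector_derivative_def subsetD)
  then obtain b where "b \<in> {c..c'}"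
    "partial_s l t c' - partial_s l t c = (c' - c) *\<^sub>R partial_c C (partial_s l) t b"
    using mvt_very_simple[of c c' "partial_s l t"
      "\<lambda>b h. h *\<^sub>R partial_c C (partial_s l) t b"] \<open>c \<le> c'\<close> by auto
  moreover from this(1) have "partial_c C (partial_s l) t b < 0"
    using sub by (intro neg) auto
  ultimately show ?thesis
    using assms(6) by (smt (verit, best) mult_nonneg_nonpos real_scaleR_def)
qed simp

text \<open>Decreasing differences: the derivative in the score of the increment from
  \<open>c\<close> to \<open>c'\<close> is a difference of two values of \<open>partial_s\<close>,
  which is nonpositive by the preceding monotonicity.\<close>

lemma loss_increment_antimono:
  fixes l :: "real \<Rightarrow> real \<Rightarrow> real"
  assumes "C2_on (\<lambda>(t, c). l t c) (UNIV \<times> C)" "is_interval C"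
    and "\<And>t c. c \<in> C \<Longrightarrow> partial_c C (partial_s l) t c < 0"
    and "c \<in> C" "c' \<in> C" "c \<le> c'" "t \<le> t'"
  shows "l t' c' - l t' c \<le> l t c' - l t c"
proof (rule DERIV_nonpos_imp_nonincreasing[OF \<open>t \<le> t'\<close>, of "\<lambda>t. l t c' - l t c"])
  fix u
  have "((\<lambda>t. l t c' - l t c) has_real_derivative partial_s l u c' - partial_s l u c) (at u)"
    using assms by (intro DERIV_diff C2_on_partial_s(1)[OF assms(1)])
  moreover have "partial_s l u c' - partial_s l u c \<le> 0"
    using partial_s_antimono[of l C c c' u] assms by simp
  ultimately show "\<exists>d. ((\<lambda>t. l t c' - l t c) has_real_derivative d) (at u) \<and> d \<le> 0"
    by blast
qed

section \<open>Projection onto the comparison values\<close>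

text \<open>\<open>arg_min\<close> is a choice operator; the strict inequality leaves it a single
  candidate.\<close>

lemma proj_on_eqI:
  assumes "c \<in> C" "\<And>d. d \<in> C \<Longrightarrow> d \<noteq> c \<Longrightarrow> \<bar>t - c\<bar> < \<bar>t - d\<bar>"
  shows "proj_on C t = c"
proof -
  have "is_arg_min (\<lambda>c. \<bar>t - c\<bar>) (\<lambda>c. c \<in> C) (proj_on C t)"
    unfolding proj_on_def arg_min_def
    by (rule someI[of _ c]) (use assms in \<open>auto simp: is_arg_min_def not_less intro: less_imp_le\<close>)
  then show ?thesis
    using assms unfolding is_arg_min_def by blast
qed

text \<open>Either \<open>C\<close> contains some \<open>d > c\<close>, and shifts up to
  \<open>d - c\<close> stay in \<open>C\<close> and are fixed by the projection, or \<open>c\<close>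
  is the maximum of \<open>C\<close> and shifts are projected back to \<open>c\<close>. Hence the
  minimum is attained even when \<open>C\<close> is not closed.\<close>

lemma proj_on_shift_right:
  assumes "is_interval C" "c \<in> C"
  obtains e where "e > 0"
    "\<And>\<epsilon>. 0 < \<epsilon> \<Longrightarrow> \<epsilon> \<le> e \<Longrightarrow> proj_on C (c + \<epsilon>) \<in> C \<and> c \<le> proj_on C (c + \<epsilon>)"
proof (cases "\<exists>d\<in>C. c < d")
  case True
  then obtain d where d: "d \<in> C" "c < d" by blast
  show ?thesis
  proof
    show "d - c > 0" using d by simp
    fix \<epsilon> assume \<epsilon>: "0 < \<epsilon>" "\<epsilon> \<le> d - c"
    then have "c + \<epsilon> \<in> C"
      using mem_is_interval_1_I[OF assms d(1)] by simp
    moreover from this have "proj_on C (c + \<epsilon>) = c + \<epsilon>"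
      by (intro proj_on_eqI) auto
    ultimately show "proj_on C (c + \<epsilon>) \<in> C \<and> c \<le> proj_on C (c + \<epsilon>)"
      using \<epsilon> by simp
  qed
next
  case False
  have "proj_on C (c + \<epsilon>) = c" if "0 < \<epsilon>" for \<epsilon>
    using that False assms(2) by (intro proj_on_eqI) force+
  then show ?thesis
    using assms(2) that[of 1] by simp
qed

lemma proj_on_shift_left:
  assumes "is_interval C" "c \<in> C"
  obtains e where "e > 0"
    "\<And>\<epsilon>. 0 < \<epsilon> \<Longrightarrow> \<epsilon> \<le> e \<Longrightarrow> proj_on C (c - \<epsilon>) \<in> C \<and> proj_on C (c - \<epsilon>) \<le> c"
proof (cases "\<exists>d\<in>C. d < c")
  case True
  then obtain d where d: "d \<in> C" "d < c" by blast
  show ?thesis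
  proof
    show "c - d > 0" using d by simp
    fix \<epsilon> assume \<epsilon>: "0 < \<epsilon>" "\<epsilon> \<le> c - d"
    then have "c - \<epsilon> \<in> C"
      using mem_is_interval_1_I[OF assms(1) d(1) assms(2)] by simp
    moreover from this have "proj_on C (c - \<epsilon>) = c - \<epsilon>"
      by (intro proj_on_eqI) auto
    ultimately show "proj_on C (c - \<epsilon>) \<in> C \<and> proj_on C (c - \<epsilon>) \<le> c"
      using \<epsilon> by simp
  qed
next
  case False
  have "proj_on C (c - \<epsilon>) = c" if "0 < \<epsilon>" for \<epsilon>
    using that False assms(2) by (intro proj_on_eqI) force+
  then show ?thesis
    using assms(2) that[of 1] by simp
qed

text \<open>The finitely many comparison values of a dataset admit a common threshold, as a finite
  conjunction of eventual properties holds eventually.\<close>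

lemma proj_on_shift_uniform:
  assumes "is_interval C" "finite F" "F \<subseteq> C"
  obtains e where "e > 0"
    "\<And>c \<epsilon>. c \<in> F \<Longrightarrow> 0 < \<epsilon> \<Longrightarrow> \<epsilon> \<le> e \<Longrightarrow>
      proj_on C (c + \<epsilon>) \<in> C \<and> c \<le> proj_on C (c + \<epsilon>) \<and>
      proj_on C (c - \<epsilon>) \<in> C \<and> proj_on C (c - \<epsilon>) \<le> c"
proof -
  let ?P = "\<lambda>c \<epsilon>. proj_on C (c + \<epsilon>) \<in> C \<and> c \<le> proj_on C (c + \<epsilon>) \<and>
    proj_on C (c - \<epsilon>) \<in> C \<and> proj_on C (c - \<epsilon>) \<le> c"
  have "\<forall>\<^sub>F \<epsilon> in at_right 0. ?P c \<epsilon>" if c: "c \<in> C" for c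
  proof -
    obtain e e' where
      "e > 0" "\<And>\<epsilon>. 0 < \<epsilon> \<Longrightarrow> \<epsilon> \<le> e \<Longrightarrow> proj_on C (c + \<epsilon>) \<in> C \<and> c \<le> proj_on C (c + \<epsilon>)"
      "e' > 0" "\<And>\<epsilon>. 0 < \<epsilon> \<Longrightarrow> \<epsilon> \<le> e' \<Longrightarrow> proj_on C (c - \<epsilon>) \<in> C \<and> proj_on C (c - \<epsilon>) \<le> c"
      using proj_on_shift_right[OF assms(1) c] proj_on_shift_left[OF assms(1) c] by metis
    then show ?thesis
      unfolding eventually_at_right_field by (intro exI[of _ "min e e'"]) auto
  qed
  then have "\<forall>\<^sub>F \<epsilon> in at_right 0. \<forall>c\<in>F. ?P c \<epsilon>"
    using assms(2,3) by (intro eventually_ball_finite) auto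
  then obtain b where "b > 0" "\<And>\<epsilon>. 0 < \<epsilon> \<Longrightarrow> \<epsilon> < b \<Longrightarrow> \<forall>c\<in>F. ?P c \<epsilon>"
    unfolding eventually_at_right_field by blast
  \<comment> \<open>Halving \<open>b\<close> turns the strict bound on \<epsilon> into the
    non-strict one.\<close>
  then show ?thesis
    using that[of "b/2"] by simp
qed

section \<open>Local pairwise monotonicity\<close>

text \<open>Writing the perturbed loss as a sum over the original \<open>D\<close> allows a
  comparison of both losses data point by data point.\<close>

lemma Loss_intensify:
  "Loss R l s (intensify C x y z \<epsilon> D) \<theta> =
    R \<theta> + (\<Sum>(x', y', z', c) \<in># D. l (score_diff s y' z' x' \<theta>) (push C x y z \<epsilon> c x' y' z'))"
  by (simp add: Loss_def intensify_def image_mset.compositionality comp_def case_prod_unfold)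

theorem theorem2:
  fixes A :: "'a set" and B :: "'b set" and C :: "real set"
    and s :: "'a \<Rightarrow> 'b \<Rightarrow> real^'d \<Rightarrow> real"
    and l :: "real \<Rightarrow> real \<Rightarrow> real"
    and R :: "real^'d \<Rightarrow> real"
    and D :: "('a, 'b) dataset"
    and \<theta>\<^sub>0 :: "real^'d"
  assumes "\<And>x y. x \<in> B \<Longrightarrow> y \<in> A \<Longrightarrow> C1_on (s y x) UNIV"
    and "is_interval C"
    and "C2_on (\<lambda>(t, c). l t c) (UNIV \<times> C)"
    and "C2_on R UNIV"
    and "\<And>t c. c \<in> C \<Longrightarrow> partial_c C (partial_s l) t c < 0"
    and "set_mset D \<subseteq> B \<times> A \<times> A \<times> C"
    and "gradient (Loss R l s D) \<theta>\<^sub>0 = 0"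
    and "twice_differentiable_at (Loss R l s D) \<theta>\<^sub>0"
    and "positive_definite (hessian (Loss R l s D) \<theta>\<^sub>0)"
    and "\<And>x y z c. (x, y, z, c) \<in># D \<Longrightarrow> gradient (score_diff s z y x) \<theta>\<^sub>0 \<noteq> 0"
  shows "locally_pairwise_monotone A B C s (Loss R l s) D \<theta>\<^sub>0"
proof -
  let ?L = "Loss R l s" and ?F = "(\<lambda>(x, y, z, c). c) ` set_mset D"
  obtain r where r: "r > 0" "\<And>\<theta>. \<theta> \<in> ball \<theta>\<^sub>0 r \<Longrightarrow> \<theta> \<noteq> \<theta>\<^sub>0 \<Longrightarrow> ?L D \<theta>\<^sub>0 < ?L D \<theta>"
    using strict_local_min_if_hessian_positive_definite[OF assms(7-9)] by blast
  \<comment> \<open>The threshold \<open>e\<close> depends only on the comparison values in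
    \<open>D\<close>, so it serves all triples \<open>(x, y, z)\<close> at once.\<close>
  have "?F \<subseteq> C"
    using assms(6) by auto
  then obtain e where e: "e > 0" "\<And>c \<epsilon>. c \<in> ?F \<Longrightarrow> 0 < \<epsilon> \<Longrightarrow> \<epsilon> \<le> e \<Longrightarrow>
      proj_on C (c + \<epsilon>) \<in> C \<and> c \<le> proj_on C (c + \<epsilon>) \<and>
      proj_on C (c - \<epsilon>) \<in> C \<and> proj_on C (c - \<epsilon>) \<le> c"
    using proj_on_shift_uniform[OF assms(2), of ?F] by auto
  have incr: "l t' c' - l t' c \<le> l t c' - l t c"
    if "c \<in> C" "c' \<in> C" "c \<le> c'" "t \<le> t'" for t t' c c'
    by (rule loss_increment_antimono) (use assms(2,3,5) that in auto)
  have "score_diff s y z x \<theta>\<^sub>0 \<le> score_diff s y z x \<theta>"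
    if \<epsilon>: "0 < \<epsilon>" "\<epsilon> \<le> e"
      and min: "is_arg_min (?L (intensify C x y z \<epsilon> D)) (\<lambda>\<theta>. \<theta> \<in> ball \<theta>\<^sub>0 r) \<theta>"
    for x y z \<epsilon> \<theta>
  proof (rule ccontr)
    assume less: "\<not> score_diff s y z x \<theta>\<^sub>0 \<le> score_diff s y z x \<theta>"
    \<comment> \<open>\<open>y \<noteq> z\<close> separates the triples \<open>(x, y, z)\<close> and
      \<open>(x, z, y)\<close>, so that the second branch of \<open>push\<close> is reached in case
      2 below.\<close>
    then have "\<theta> \<noteq> \<theta>\<^sub>0" "y \<noteq> z"
      by (auto simp: score_diff_def)
    with min r have "?L D \<theta>\<^sub>0 < ?L D \<theta>"
      by (simp add: is_arg_min_def)
    let ?h = "\<lambda>\<theta>. \<lambda>(x', y', z', c). l (score_diff s y' z' x' \<theta>) c"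
    let ?h' = "\<lambda>\<theta>. \<lambda>(x', y', z', c). l (score_diff s y' z' x' \<theta>) (push C x y z \<epsilon> c x' y' z')"
    \<comment> \<open>The perturbation \<open>?h' - ?h\<close> of each data point is at least as
      large at \<theta> as at \<open>\<theta>\<^sub>0\<close>; the additive form avoids subtraction
      under the multiset sum.\<close>
    have "?h \<theta> p + ?h' \<theta>\<^sub>0 p \<le> ?h \<theta>\<^sub>0 p + ?h' \<theta> p" if p: "p \<in># D" for p
    proof -
      obtain x' y' z' c where p_eq: "p = (x', y', z', c)"
        by (cases p)
      have "c \<in> ?F"
        using p unfolding p_eq by force
      then have c: "c \<in> C" "proj_on C (c + \<epsilon>) \<in> C" "c \<le> proj_on C (c + \<epsilon>)"
          "proj_on C (c - \<epsilon>) \<in> C" "proj_on C (c - \<epsilon>) \<le> c"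
        using e(2)[OF _ \<epsilon>] \<open>?F \<subseteq> C\<close> by auto
      consider "(x', y', z') = (x, z, y)" | "(x', y', z') = (x, y, z)"
        | "(x', y', z') \<noteq> (x, y, z)" "(x', y', z') \<noteq> (x, z, y)" by blast
      then show ?thesis
      proof cases
        \<comment> \<open>For the reversed pair both signs flip: the comparison value decreases
          while the score difference increases from \<open>\<theta>\<^sub>0\<close> to \<theta>. The
          increment from the projected value up to \<open>c\<close> is therefore the one to
          compare.\<close>
        case 1
        have "score_diff s z y x \<theta>\<^sub>0 \<le> score_diff s z y x \<theta>"
          using less by (simp add: score_diff_def)
        from incr[OF c(4,1,5) this] 1 show ?thesis
          by (simp add: p_eq push_def algebra_simps)
      next
        case 2
        have "score_diff s y z x \<theta> \<le> score_diff s y z x \<theta>\<^sub>0"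
          using less by simp
        from incr[OF c(1-3) this] 2 \<open>y \<noteq> z\<close> show ?thesis
          by (simp add: p_eq push_def algebra_simps)
      next
        case 3
        then have "push C x y z \<epsilon> c x' y' z' = c"
          by (simp only: push_def if_False)
        then show ?thesis
          by (simp add: p_eq)
      qed
    qed
    then have "(\<Sum>p\<in>#D. ?h \<theta> p + ?h' \<theta>\<^sub>0 p) \<le> (\<Sum>p\<in>#D. ?h \<theta>\<^sub>0 p + ?h' \<theta> p)"
      by (rule sum_mset_mono)
    \<comment> \<open>The regularization contributes \<open>R \<theta> + R \<theta>\<^sub>0\<close>
      to both sides.\<close>
    then have "?L D \<theta> + ?L (intensify C x y z \<epsilon> D) \<theta>\<^sub>0 \<le> ?L D \<theta>\<^sub>0 + ?L (intensify C x y z \<epsilon> D) \<theta>"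
      unfolding Loss_intensify by (simp add: Loss_def sum_mset.distrib)
    moreover have "?L (intensify C x y z \<epsilon> D) \<theta> \<le> ?L (intensify C x y z \<epsilon> D) \<theta>\<^sub>0"
      using min r(1) by (simp add: is_arg_min_linorder)
    ultimately show False
      using \<open>?L D \<theta>\<^sub>0 < ?L D \<theta>\<close> by simp
  qed
  then show ?thesis
    unfolding locally_pairwise_monotone_def using r(1) e(1)
    by (intro exI[of _ "ball \<theta>\<^sub>0 r"] exI[of _ e]) auto
qed

end
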